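(* (L-optimality) Consider subsampling probabilities $\{\pi_i\}_{i=1}^n$ for the functional linear multiplicative model under the least product relative error criterion, with $\boldsymbol V_\pi$ defined in the context. If the subsampling probabilities $\pi_i$, $i=1,\dots,n$, are chosen as $$\pi_i^{FLopt}=\frac{\left|-y_i\exp(-\boldsymbol B_i^T\hat{\boldsymbol\theta}_{full})+y_i^{-1}\exp(\boldsymbol B_i^T\hat{\boldsymbol\theta}_{full})\right|\,\|\boldsymbol B_i\|_2}{\sum_{j=1}^n\left|-y_j\exp(-\boldsymbol B_j^T\hat{\boldsymbol\theta}_{full})+y_j^{-1}\exp(\boldsymbol B_j^T\hat{\boldsymbol\theta}_{full})\right|\,\|\boldsymbol B_j\|_2},$$ then $\mathrm{tr}(\boldsymbol V_\pi)$ attains its minimum over all choices of subsampling probabilities.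
   Context: Data: $(x_i(t),y_i)$, $i=1,\dots,n$, with $x_i$ square integrable on $[0,1]$ and $y_i>0$, from the model $y=\exp\left(\int_0^1X(t)\beta(t)\,dt\right)\epsilon$ with $\epsilon>0$. B-splines: let $0=t_0<t_1<\dots<t_K<t_{K+1}=1$ be equispaced knots, and let $\boldsymbol B(t)=(B_1(t),\dots,B_{K+p+1}(t))^T$ be the normalized B-spline basis of degree $p$ on each sub-interval $[t_j,t_{j+1}]$ and $p-1$ times continuously differentiable on $[0,1]$. Let $\boldsymbol B^{(q)}(t)$ be the vector of $q$-th derivatives of the basis functions, $q\le p$ an integer. Put $\boldsymbol B_i=\int_0^1x_i(t)\boldsymbol B(t)\,dt$, $\boldsymbol D_q=\int_0^1\boldsymbol B^{(q)}(t)\{\boldsymbol B^{(q)}(t)\}^T\,dt$, $\omega_i(\boldsymbol\theta)=y_i\exp(-\boldsymbol B_i^T\boldsymbol\theta)$. Full-data estimator: $\hat{\boldsymbol\theta}_{full}$ minimizes $\sum_{i=1}^n\{\omega_i(\boldsymbol\theta)+\omega_i(\boldsymbol\theta)^{-1}-2\}+\frac\lambda2\boldsymbol\theta^T\boldsymbol D_q\boldsymbol\theta$ over $\boldsymbol\theta\in\mathbb R^{K+p+1}$, with $\lambda>0$. Subsampling probabilities are numbers $\pi_1,\dots,\pi_n\ge0$ with $\sum_i\pi_i=1$, and $$\boldsymbol V_\pi=\frac1{n^2}\sum_{i=1}^n\frac1{\pi_i}\{-\omega_i(\hat{\boldsymbol\theta}_{full})+\omega_i(\hat{\boldsymbol\theta}_{full})^{-1}\}^2\boldsymbol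 B_i\boldsymbol B_i^T.$$ Here $\|\cdot\|_2$ of a vector is the Euclidean norm. The data, $K,p,q,\lambda$ are fixed and the minimization is over $(\pi_1,\dots,\pi_n)$. It is understood that the denominator of $\pi_i^{FLopt}$ is nonzero; a summand of $\boldsymbol V_\pi$ whose matrix factor $\{\cdot\}^2\boldsymbol B_i\boldsymbol B_i^T$ vanishes is taken to be $0$ even if $\pi_i=0$, and $\pi_i>0$ is required for all other $i$. *)

theory Defs
  imports "HOL-Analysis.Analysis"
begin

definition square_integrable :: "real set \<Rightarrow> (real \<Rightarrow> real) \<Rightarrow> bool" where
  "square_integrable S f \<longleftrightarrow>
     f \<in> borel_measurable (lebesgue_on S) \<and> integrable (lebesgue_on S) (\<lambda>t. (f t)\<^sup>2)"

(* The knot t_j of the mathematical text is tau (p + j). Only t_0, ..., t_{K+1} are prescribed;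
   the p auxiliary knots needed on either side of [0,1] may be chosen freely (coincident or
   equispaced, for example). *)
definition bspline_knots :: "nat \<Rightarrow> nat \<Rightarrow> (nat \<Rightarrow> real) \<Rightarrow> bool" where
  "bspline_knots K p \<tau> \<longleftrightarrow>
     mono_on {0..K + 2 * p + 1} \<tau> \<and> (\<forall>j\<le>K + 1. \<tau> (p + j) = real j / real (K + 1))"

(* Normalized B-spline of degree d supported on [tau i, tau (i + d + 1)], by the Cox-de Boor
   recursion. A quotient with vanishing denominator (coincident knots) is 0, as is customary.
   From t = 1 on, the intervals of the degree 0 case are closed on the right instead of on the
   left, so that on [0,1] the splines are continuous from the left at the endpoint 1. *)
fun bspline :: "(nat \<Rightarrow> real) \<Rightarrow> nat \<Rightarrow> nat \<Rightarrow> real \<Rightarrow> real" where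
  "bspline \<tau> 0 i t =
     (if (if t < 1 then \<tau> i \<le> t \<and> t < \<tau> (i + 1) else \<tau> i < t \<and> t \<le> \<tau> (i + 1)) then 1 else 0)"
| "bspline \<tau> (Suc d) i t =
     (t - \<tau> i) / (\<tau> (i + d + 1) - \<tau> i) * bspline \<tau> d i t
     + (\<tau> (i + d + 2) - t) / (\<tau> (i + d + 2) - \<tau> (i + 1)) * bspline \<tau> d (i + 1) t"

(* The vector of q-th derivatives of all basis functions; q = 0 gives the basis itself.
   The K + p + 1 basis functions are numbered from 0, and idx enumerates the coordinates.
   For q = p the derivative does not exist at the knots, and at 0 and 1 the two-sided derivative
   may depend on the splines outside [0,1]; the vector is only used under integrals over [0,1],
   where these finitely many points do not matter. *)
definition bspline_vec ::
    "(nat \<Rightarrow> real) \<Rightarrow> nat \<Rightarrow> ('n \<Rightarrow> nat) \<Rightarrow> nat \<Rightarrow> real \<Rightarrow> real ^ 'n::finite" where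
  "bspline_vec \<tau> p idx q t = (\<chi> a. (deriv ^^ q) (bspline \<tau> p (idx a)) t)"

definition self_outer :: "real ^ 'n \<Rightarrow> real ^ 'n ^ 'n" where
  "self_outer v = (columnvector v :: real ^ 1 ^ 'n) ** (rowvector v :: real ^ 'n ^ 1)"

definition basis_score ::
    "(nat \<Rightarrow> real) \<Rightarrow> nat \<Rightarrow> ('n \<Rightarrow> nat) \<Rightarrow> (real \<Rightarrow> real) \<Rightarrow> real ^ 'n::finite" where
  "basis_score \<tau> p idx f = (LINT t|lebesgue_on {0..1}. f t *\<^sub>R bspline_vec \<tau> p idx 0 t)"

definition penalty_matrix ::
    "(nat \<Rightarrow> real) \<Rightarrow> nat \<Rightarrow> ('n \<Rightarrow> nat) \<Rightarrow> nat \<Rightarrow> real ^ 'n::finite ^ 'n" where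
  "penalty_matrix \<tau> p idx q = (LINT t|lebesgue_on {0..1}. self_outer (bspline_vec \<tau> p idx q t))"

definition omega :: "(nat \<Rightarrow> real) \<Rightarrow> (nat \<Rightarrow> real ^ 'n) \<Rightarrow> nat \<Rightarrow> real ^ 'n::finite \<Rightarrow> real" where
  "omega y B i \<theta> = y i * exp (- (B i \<bullet> \<theta>))"

definition full_objective ::
    "nat \<Rightarrow> (nat \<Rightarrow> real) \<Rightarrow> (nat \<Rightarrow> real ^ 'n) \<Rightarrow> real ^ 'n ^ 'n \<Rightarrow> real \<Rightarrow> real ^ 'n::finite \<Rightarrow> real" where
  "full_objective n y B D lam \<theta> =
     (\<Sum>i=1..n. (omega y B i \<theta> + inverse (omega y B i \<theta>) - 2)) + lam / 2 * (\<theta> \<bullet> (D *v \<theta>))"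

definition full_estimator ::
    "nat \<Rightarrow> (nat \<Rightarrow> real) \<Rightarrow> (nat \<Rightarrow> real ^ 'n) \<Rightarrow> real ^ 'n ^ 'n \<Rightarrow> real \<Rightarrow> real ^ 'n::finite \<Rightarrow> bool" where
  "full_estimator n y B D lam \<theta> \<longleftrightarrow> is_arg_min (full_objective n y B D lam) (\<lambda>_. True) \<theta>"

definition score_matrix ::
    "(nat \<Rightarrow> real) \<Rightarrow> (nat \<Rightarrow> real ^ 'n) \<Rightarrow> real ^ 'n \<Rightarrow> nat \<Rightarrow> real ^ 'n::finite ^ 'n" where
  "score_matrix y B \<theta> i =
     (- omega y B i \<theta> + inverse (omega y B i \<theta>))\<^sup>2 *\<^sub>R self_outer (B i)"

definition subsampling_probs ::
    "nat \<Rightarrow> (nat \<Rightarrow> real) \<Rightarrow> (nat \<Rightarrow> real ^ 'n) \<Rightarrow> real ^ 'n::finite \<Rightarrow> (nat \<Rightarrow> real) \<Rightarrow> bool" where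
  "subsampling_probs n y B \<theta> \<pi> \<longleftrightarrow>
     (\<forall>i\<in>{1..n}. \<pi> i \<ge> 0) \<and> (\<Sum>i=1..n. \<pi> i) = 1 \<and>
     (\<forall>i\<in>{1..n}. score_matrix y B \<theta> i \<noteq> 0 \<longrightarrow> \<pi> i > 0)"

(* A summand with vanishing score matrix is 0 also when pi i = 0. *)
definition V_matrix ::
    "nat \<Rightarrow> (nat \<Rightarrow> real) \<Rightarrow> (nat \<Rightarrow> real ^ 'n) \<Rightarrow> real ^ 'n \<Rightarrow> (nat \<Rightarrow> real) \<Rightarrow> real ^ 'n::finite ^ 'n" where
  "V_matrix n y B \<theta> \<pi> =
     (1 / (real n)\<^sup>2) *\<^sub>R (\<Sum>i=1..n. (1 / \<pi> i) *\<^sub>R score_matrix y B \<theta> i)"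

definition flopt_weight ::
    "(nat \<Rightarrow> real) \<Rightarrow> (nat \<Rightarrow> real ^ 'n) \<Rightarrow> real ^ 'n \<Rightarrow> nat \<Rightarrow> real" where
  "flopt_weight y B \<theta> i =
     \<bar>- y i * exp (- (B i \<bullet> \<theta>)) + inverse (y i) * exp (B i \<bullet> \<theta>)\<bar> * norm (B i)"

definition pi_FLopt ::
    "nat \<Rightarrow> (nat \<Rightarrow> real) \<Rightarrow> (nat \<Rightarrow> real ^ 'n) \<Rightarrow> real ^ 'n \<Rightarrow> nat \<Rightarrow> real" where
  "pi_FLopt n y B \<theta> i = flopt_weight y B \<theta> i / (\<Sum>j=1..n. flopt_weight y B \<theta> j)"

end

theory Submission
  imports Defs
begin

text \<open>
  Since the trace of \<open>v v\<^sup>T\<close> is the squared length of \<open>v\<close>, the trace of \<open>V_matrix\<close> depends on the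
  data only through the weights \<open>w i = flopt_weight y B \<theta> i\<close>: up to the factor \<open>1 / n\<^sup>2\<close> it is
  \<open>\<Sum>i. (w i)\<^sup>2 / \<pi> i\<close> (lemma \<open>trace_V_matrix\<close>). For admissible \<open>\<pi>\<close> this sum is at least
  \<open>(\<Sum>i. w i)\<^sup>2\<close>, a form of the Cauchy-Schwarz inequality (lemma
  \<open>square_sum_le_sum_squares_over_probs\<close>), and probabilities proportional to the weights attain this
  bound (lemma \<open>sum_squares_over_proportional\<close>).
\<close>

lemma square_sum_le_sum_squares_over_probs:
  fixes w \<pi> :: "'a \<Rightarrow> real"
  assumes "\<And>i. i \<in> A \<Longrightarrow> \<pi> i \<ge> 0"
    and "sum \<pi> A = 1"
    and "\<And>i. i \<in> A \<Longrightarrow> w i \<noteq> 0 \<Longrightarrow> \<pi> i > 0"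
  shows "(sum w A)\<^sup>2 \<le> (\<Sum>i\<in>A. (w i)\<^sup>2 / \<pi> i)"
proof -
  define S where "S = sum w A"
  (* For w i / S > 0 the left-hand side is the tangent of the convex function p \<mapsto> (w i)\<^sup>2 / p on
     p > 0 at the point p = w i / S. All these tangents have the same slope - S\<^sup>2, so the sum of
     the bounds depends on \<pi> only through sum \<pi> A. *)
  have tangent: "2 * S * w i - S\<^sup>2 * \<pi> i \<le> (w i)\<^sup>2 / \<pi> i" if "i \<in> A" for i
  proof (cases "w i = 0")
    case True
    then show ?thesis
      using assms(1)[OF that] by simp
  next
    case False
    then have pos: "\<pi> i > 0"
      using assms(3) that by blast
    have "0 \<le> (w i - S * \<pi> i)\<^sup>2 / \<pi> i"
      using pos by simp
    also have "\<dots> = (w i)\<^sup>2 / \<pi> i - (2 * S * w i - S\<^sup>2 * \<pi> i)"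
      using pos by (simp add: field_simps power2_eq_square)
    finally show ?thesis
      by simp
  qed
  have "S\<^sup>2 = (\<Sum>i\<in>A. 2 * S * w i - S\<^sup>2 * \<pi> i)"
    using assms(2)
    by (simp add: sum_subtractf S_def power2_eq_square flip: sum_distrib_left)
  also have "\<dots> \<le> (\<Sum>i\<in>A. (w i)\<^sup>2 / \<pi> i)"
    by (rule sum_mono) (rule tangent)
  finally show ?thesis
    by (simp add: S_def)
qed

lemma sum_squares_over_proportional:
  fixes w :: "'a \<Rightarrow> real"
  shows "(\<Sum>i\<in>A. (w i)\<^sup>2 / (w i / sum w A)) = (sum w A)\<^sup>2"
proof -
  (* If w i = 0, or if the weights sum to 0, the quotient has denominator 0; its default value 0
     is then also the value of the right-hand summand. *)
  have "(\<Sum>i\<in>A. (w i)\<^sup>2 / (w i / sum w A)) = (\<Sum>i\<in>A. w i * sum w A)"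
    by (rule sum.cong) (simp_all add: power2_eq_square)
  then show ?thesis
    by (simp add: power2_eq_square flip: sum_distrib_right)
qed

lemma trace_scaleR: "trace (c *\<^sub>R M) = c * trace (M :: real ^ 'n ^ 'n)"
  by (simp add: trace_def sum_distrib_left)

lemma trace_sum: "trace (\<Sum>i\<in>A. M i) = (\<Sum>i\<in>A. trace (M i :: real ^ 'n ^ 'n))"
  by (simp add: trace_def sum.swap[of _ A])

lemma trace_self_outer: "trace (self_outer v) = (norm v)\<^sup>2"
  by (simp add: trace_def self_outer_def matrix_matrix_mult_def columnvector_def rowvector_def
      power2_norm_eq_inner inner_vec_def)

lemma flopt_weight_eq:
  "flopt_weight y B \<theta> i = \<bar>- omega y B i \<theta> + inverse (omega y B i \<theta>)\<bar> * norm (B i)"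
  by (simp add: flopt_weight_def omega_def exp_minus)

lemma flopt_weight_nonneg: "flopt_weight y B \<theta> i \<ge> 0"
  by (simp add: flopt_weight_def)

lemma trace_score_matrix: "trace (score_matrix y B \<theta> i) = (flopt_weight y B \<theta> i)\<^sup>2"
  by (simp add: score_matrix_def trace_scaleR trace_self_outer flopt_weight_eq power_mult_distrib)

text \<open>
  Being a nonnegative multiple of \<open>v v\<^sup>T\<close>, a score matrix vanishes as soon as its trace does.
  Hence positivity of \<open>\<pi> i\<close> is required exactly where the weight is nonzero.
\<close>

lemma score_matrix_eq_0_iff: "score_matrix y B \<theta> i = 0 \<longleftrightarrow> flopt_weight y B \<theta> i = 0"
proof
  assume "score_matrix y B \<theta> i = 0"
  then have "(flopt_weight y B \<theta> i)\<^sup>2 = 0"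
    using trace_score_matrix[of y B \<theta> i] by (simp add: trace_def)
  then show "flopt_weight y B \<theta> i = 0"
    by simp
next
  assume "flopt_weight y B \<theta> i = 0"
  then have "- omega y B i \<theta> + inverse (omega y B i \<theta>) = 0 \<or> B i = 0"
    by (auto simp: flopt_weight_eq)
  moreover have "self_outer 0 = (0 :: real ^ 'n ^ 'n)"
    by (simp add: self_outer_def matrix_matrix_mult_def columnvector_def vec_eq_iff)
  ultimately show "score_matrix y B \<theta> i = 0"
    by (auto simp: score_matrix_def)
qed

lemma trace_V_matrix:
  "trace (V_matrix n y B \<theta> \<pi>) = 1 / (real n)\<^sup>2 * (\<Sum>i=1..n. (flopt_weight y B \<theta> i)\<^sup>2 / \<pi> i)"
  by (simp add: V_matrix_def trace_scaleR trace_sum trace_score_matrix)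

lemma subsampling_probs_pi_FLopt:
  assumes "(\<Sum>j=1..n. flopt_weight y B \<theta> j) \<noteq> 0"
  shows "subsampling_probs n y B \<theta> (pi_FLopt n y B \<theta>)"
proof -
  define S where "S = (\<Sum>j=1..n. flopt_weight y B \<theta> j)"
  have S: "S > 0"
    using assms flopt_weight_nonneg[of y B \<theta>] unfolding S_def
    by (metis sum_nonneg order_le_less)
  have "pi_FLopt n y B \<theta> = (\<lambda>i. flopt_weight y B \<theta> i / S)"
    by (simp add: fun_eq_iff pi_FLopt_def S_def)
  moreover have "(\<Sum>i=1..n. flopt_weight y B \<theta> i / S) = 1"
    using S by (simp add: S_def flip: sum_divide_distrib)
  ultimately show ?thesis
    using S flopt_weight_nonneg[of y B \<theta>]
    by (simp add: subsampling_probs_def score_matrix_eq_0_iff less_le)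
qed

theorem theorem4:
  fixes n K p q :: nat
    and x :: "nat \<Rightarrow> real \<Rightarrow> real" and y \<epsilon> :: "nat \<Rightarrow> real" and \<beta> :: "real \<Rightarrow> real"
    and \<tau> :: "nat \<Rightarrow> real" and idx :: "'n::finite \<Rightarrow> nat"
    and lam :: real
    and B :: "nat \<Rightarrow> real ^ 'n" and D :: "real ^ 'n ^ 'n" and \<theta>_full :: "real ^ 'n"
  assumes "\<And>i. i \<in> {1..n} \<Longrightarrow> square_integrable {0..1} (x i)"
    and "\<And>i. i \<in> {1..n} \<Longrightarrow> y i > 0"
    and "\<And>i. i \<in> {1..n} \<Longrightarrow> \<epsilon> i > 0"
    and "\<And>i. i \<in> {1..n} \<Longrightarrow> integrable (lebesgue_on {0..1}) (\<lambda>t. x i t * \<beta> t)"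
    and "\<And>i. i \<in> {1..n} \<Longrightarrow> y i = exp (LINT t|lebesgue_on {0..1}. x i t * \<beta> t) * \<epsilon> i"
    and "bspline_knots K p \<tau>"
    and "bij_betw idx UNIV {0..<K + p + 1}"
    and "q \<le> p"
    and "lam > 0"
    and "B = (\<lambda>i. basis_score \<tau> p idx (x i))"
    and "D = penalty_matrix \<tau> p idx q"
    and "full_estimator n y B D lam \<theta>_full"
    and "(\<Sum>j=1..n. flopt_weight y B \<theta>_full j) \<noteq> 0"
  shows "is_arg_min (\<lambda>\<pi>. trace (V_matrix n y B \<theta>_full \<pi>)) (subsampling_probs n y B \<theta>_full)
           (pi_FLopt n y B \<theta>_full)"
proof -
  let ?w = "flopt_weight y B \<theta>_full"
  have "trace (V_matrix n y B \<theta>_full (pi_FLopt n y B \<theta>_full)) \<le> trace (V_matrix n y B \<theta>_full \<pi>)"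
    if "subsampling_probs n y B \<theta>_full \<pi>" for \<pi>
  proof -
    have "(\<Sum>i=1..n. (?w i)\<^sup>2 / pi_FLopt n y B \<theta>_full i) = (\<Sum>i=1..n. ?w i)\<^sup>2"
      unfolding pi_FLopt_def by (rule sum_squares_over_proportional)
    also have "\<dots> \<le> (\<Sum>i=1..n. (?w i)\<^sup>2 / \<pi> i)"
      using that
      by (intro square_sum_le_sum_squares_over_probs)
        (auto simp: subsampling_probs_def score_matrix_eq_0_iff)
    finally show ?thesis
      unfolding trace_V_matrix by (rule mult_left_mono) simp
  qed
  then show ?thesis
    using subsampling_probs_pi_FLopt[OF assms(13)]
    by (auto simp: is_arg_min_def not_less)
qed

end
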